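(* Let $R$ be a commutative ring, and let $\mathfrak a,\mathfrak b\subseteq R$ be ideals with $\mathfrak a\subseteq\mathfrak b\subseteq\sqrt{\mathfrak a}$. a) A weakly $\mathfrak b$-quasifair $R$-module is weakly $\mathfrak a$-quasifair. b) If $\mathfrak b$ is weakly quasifair, then so is $\mathfrak a$. c) If $\mathfrak b$ is half-centred, centred, or well-centred, respectively, then so is $\mathfrak a$.
   Context: Rings are commutative with unit (possibly zero). For a ring $R$, an ideal $\mathfrak a\subseteq R$ and an $R$-module $M$: $\operatorname{Var}(\mathfrak a)=\{\mathfrak p\in\operatorname{Spec}(R)\mid\mathfrak a\subseteq\mathfrak p\}$; $\Gamma_{\mathfrak a}(M)=\{x\in M\mid\exists n\in\mathbb N:\mathfrak a^n\subseteq(0:_Rx)\}$; $\operatorname{Ass}^{\mathrm f}_R(M)=\{\mathfrak p\in\operatorname{Spec}(R)\mid\exists x\in M:\mathfrak p\in\min(0:_Rx)\}$ (weak assassin), where $\min(\mathfrak b)$ is the set of minimal elements of $\operatorname{Var}(\mathfrak b)$. An $R$-module $M$ is weakly $\mathfrak a$-quasifair if $\operatorname{Ass}^{\mathrm f}_R(\Gamma_{\mathfrak a}(M))=\operatorname{Ass}^{\mathrm f}_R(M)\cap\operatorname{Var}(\mathfrak a)$; the ideal $\mathfrak a$ is weakly quasifair if every $R$-module is weakly $\mathfrak a$-quasifair. The ideal $\mathfrak a$ is centred if, for every $R$-module $M$, $\Gamma_{\mathfrak a}(M)=0\Leftrightarrow\operatorname{Ass}^{\mathrm f}_R(M)\cap\operatorname{Var}(\mathfrak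 a)=\emptyset$; half-centred if, for every $R$-module $M$, $\Gamma_{\mathfrak a}(M)=M\Leftrightarrow\operatorname{Ass}^{\mathrm f}_R(M)\subseteq\operatorname{Var}(\mathfrak a)$; well-centred if it is both centred and half-centred. *)

theory Defs
  imports "HOL-Algebra.Algebra"
begin

definition Spec :: "('a, 'r) ring_scheme \<Rightarrow> 'a set set" where
  "Spec R = {P. primeideal P R}"

definition Var :: "('a, 'r) ring_scheme \<Rightarrow> 'a set \<Rightarrow> 'a set set" where
  "Var R I = {P \<in> Spec R. I \<subseteq> P}"

definition radical :: "('a, 'r) ring_scheme \<Rightarrow> 'a set \<Rightarrow> 'a set" where
  "radical R I = {x \<in> carrier R. \<exists>n::nat. x [^]\<^bsub>R\<^esub> n \<in> I}"

definition min_primes :: "('a, 'r) ring_scheme \<Rightarrow> 'a set \<Rightarrow> 'a set set" where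
  "min_primes R I = {P \<in> Var R I. \<forall>Q \<in> Var R I. Q \<subseteq> P \<longrightarrow> Q = P}"

definition annihilator ::
  "('a, 'r) ring_scheme \<Rightarrow> ('a, 'm, 'z) module_scheme \<Rightarrow> 'm \<Rightarrow> 'a set" where
  "annihilator R M x = {r \<in> carrier R. r \<odot>\<^bsub>M\<^esub> x = \<zero>\<^bsub>M\<^esub>}"

definition weak_Ass ::
  "('a, 'r) ring_scheme \<Rightarrow> ('a, 'm, 'z) module_scheme \<Rightarrow> 'a set set" where
  "weak_Ass R M = {P \<in> Spec R. \<exists>x \<in> carrier M. P \<in> min_primes R (annihilator R M x)}"

text \<open>Powers of an ideal are taken in the multiplicative monoid of ideals, so that the
  zeroth power is the whole ring.\<close>

definition torsion ::
  "('a, 'r) ring_scheme \<Rightarrow> 'a set \<Rightarrow> ('a, 'm, 'z) module_scheme \<Rightarrow> 'm set" where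
  "torsion R I M =
     {x \<in> carrier M. \<exists>n::nat. I [^]\<^bsub>ideals_set R\<^esub> n \<subseteq> annihilator R M x}"

definition weakly_quasifair_module ::
  "('a, 'r) ring_scheme \<Rightarrow> 'a set \<Rightarrow> ('a, 'm, 'z) module_scheme \<Rightarrow> bool" where
  "weakly_quasifair_module R I M \<longleftrightarrow>
     weak_Ass R (M\<lparr>carrier := torsion R I M\<rparr>) = weak_Ass R M \<inter> Var R I"

text \<open>HOL cannot quantify over types inside a formula. In the following properties of ideals,
  the type argument plays the role of the universe: ``every module'' ranges over all modules
  whose carrier is a set of elements of that type.\<close>

definition weakly_quasifair :: "'m itself \<Rightarrow> ('a, 'r) ring_scheme \<Rightarrow> 'a set \<Rightarrow> bool" where
  "weakly_quasifair (U :: 'm itself) R I \<longleftrightarrow>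
     (\<forall>M :: ('a, 'm) module. module R M \<longrightarrow> weakly_quasifair_module R I M)"

definition centred :: "'m itself \<Rightarrow> ('a, 'r) ring_scheme \<Rightarrow> 'a set \<Rightarrow> bool" where
  "centred (U :: 'm itself) R I \<longleftrightarrow>
     (\<forall>M :: ('a, 'm) module. module R M \<longrightarrow>
        (torsion R I M = {\<zero>\<^bsub>M\<^esub>} \<longleftrightarrow> weak_Ass R M \<inter> Var R I = {}))"

definition half_centred :: "'m itself \<Rightarrow> ('a, 'r) ring_scheme \<Rightarrow> 'a set \<Rightarrow> bool" where
  "half_centred (U :: 'm itself) R I \<longleftrightarrow>
     (\<forall>M :: ('a, 'm) module. module R M \<longrightarrow>
        (torsion R I M = carrier M \<longleftrightarrow> weak_Ass R M \<subseteq> Var R I))"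

definition well_centred :: "'m itself \<Rightarrow> ('a, 'r) ring_scheme \<Rightarrow> 'a set \<Rightarrow> bool" where
  "well_centred U R I \<longleftrightarrow> centred U R I \<and> half_centred U R I"

end

theory Submission
  imports Defs
begin

text \<open>
  Write \<open>\<Gamma>(I)\<close> for the \<open>I\<close>-torsion of a module \<open>M\<close>. Since primes absorb radicals,
  \<open>I\<close> and \<open>J\<close> have the same variety \<open>V\<close>, whereas powers are monotone, so
  \<open>\<Gamma>(J) \<subseteq> \<Gamma>(I) \<subseteq> M\<close> (without finite generation the first inclusion may be strict).
  Hence the weak assassin, which is monotone, gives
  \<open>weak_Ass \<Gamma>(J) \<subseteq> weak_Ass \<Gamma>(I) \<subseteq> weak_Ass M \<inter> V\<close>, where the last inclusion holds because a
  prime over the annihilator of an \<open>I\<close>-torsion element contains a power of \<open>I\<close>, hence \<open>I\<close>.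

  Each property thus has one implication that holds for every ideal and one that passes from
  \<open>J\<close> to \<open>I\<close>. Weak quasifairness makes the outer terms of the chain equal, so the middle one
  agrees with them. For half-centredness, \<open>\<Gamma>(I) = M\<close> always forces \<open>weak_Ass M \<subseteq> V\<close>
  (\<open>weak_Ass_subset_Var\<close>); conversely \<open>weak_Ass M \<subseteq> V\<close> yields \<open>\<Gamma>(J) = M\<close>, a fortiori
  \<open>\<Gamma>(I) = M\<close>. For centredness, \<open>\<Gamma>(I) = 0\<close> yields \<open>\<Gamma>(J) = 0\<close> and hence
  \<open>weak_Ass M \<inter> V = \<emptyset>\<close>; conversely a nonzero torsion element would have a proper annihilator,
  and a minimal prime of it, which exists by Zorn's lemma (\<open>exists_min_prime\<close>), would be a
  member of \<open>weak_Ass M \<inter> V\<close> (\<open>torsion_trivial_if_no_weak_Ass\<close>).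
\<close>

section \<open>Existence of minimal primes\<close>

lemma (in cring) exists_prime_over_proper_ideal:
  assumes A: "ideal A R" and one: "\<one> \<notin> A"
  shows "Var R A \<noteq> {}"
proof -
  let ?F = "{B. ideal B R \<and> A \<subseteq> B \<and> \<one> \<notin> B}"
  have "\<exists>M\<in>?F. \<forall>B\<in>?F. M \<subseteq> B \<longrightarrow> B = M"
  proof (rule subset_Zorn_nonempty)
    show "?F \<noteq> {}" using assms by blast
  next
    fix C assume C: "C \<noteq> {}" "subset.chain ?F C"
    then have "subset.chain {I. ideal I R} C"
      by (auto simp: subset_chain_def)
    from chain_Union_is_ideal[OF this] C(1) have "ideal (\<Union>C) R" by simp
    with C show "\<Union>C \<in> ?F" by (fastforce simp: subset_chain_def)
  qed
  then obtain M where "M \<in> ?F" and max: "\<forall>B\<in>?F. M \<subseteq> B \<longrightarrow> B = M" ..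
  then have M: "ideal M R" "A \<subseteq> M" "\<one> \<notin> M" by auto
  have "maximalideal M R"
  proof (rule maximalidealI[OF M(1)])
    show "carrier R \<noteq> M" using M(3) by blast
    fix B assume B: "ideal B R" "M \<subseteq> B"
    then show "B = M \<or> B = carrier R"
      using bspec[OF max, of B] M(2) ideal.one_imp_carrier[OF B(1)] by blast
  qed
  then have "primeideal M R" by (rule maximalideal_prime)
  with M(2) show ?thesis by (auto simp: Var_def Spec_def)
qed

text \<open>If a product lies in every member of the chain while one factor misses the member \<open>P\<close>
  and the other misses \<open>Q\<close>, then both factors miss the smaller of \<open>P\<close> and \<open>Q\<close>, which is
  prime.\<close>

lemma (in cring) chain_Inter_is_prime:
  assumes primes: "\<And>P. P \<in> C \<Longrightarrow> primeideal P R" and nonempty: "C \<noteq> {}"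
    and chain: "\<And>P Q. P \<in> C \<Longrightarrow> Q \<in> C \<Longrightarrow> P \<subseteq> Q \<or> Q \<subseteq> P"
  shows "primeideal (\<Inter>C) R"
proof (rule primeidealI)
  show "ideal (\<Inter>C) R"
    by (rule i_Intersect[OF primeideal.axioms(1)[OF primes] nonempty])
  show "cring R" by (rule is_cring)
  obtain P where P: "P \<in> C" using nonempty by blast
  then have "\<one> \<notin> P"
    using primeideal.I_notcarr[OF primes] ideal.one_imp_carrier primeideal.axioms(1)[OF primes]
    by metis
  then show "carrier R \<noteq> \<Inter>C" using P by blast
next
  fix a b assume ab: "a \<in> carrier R" "b \<in> carrier R" "a \<otimes> b \<in> \<Inter>C"
  show "a \<in> \<Inter>C \<or> b \<in> \<Inter>C"
  proof (rule ccontr)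
    assume "\<not> ?thesis"
    then obtain P Q where PQ: "P \<in> C" "a \<notin> P" "Q \<in> C" "b \<notin> Q" by blast
    then obtain N where "N \<in> C" "a \<notin> N" "b \<notin> N" using chain[of P Q] by blast
    with ab show False using primeideal.I_prime[OF primes] by blast
  qed
qed

text \<open>Zorn's lemma is applied to the complements of the primes over \<open>A\<close>, turning minimality
  into maximality.\<close>

lemma (in cring) exists_min_prime:
  assumes "ideal A R" "\<one> \<notin> A"
  shows "\<exists>P. P \<in> min_primes R A"
proof -
  have "\<exists>M\<in>uminus ` Var R A. \<forall>B\<in>uminus ` Var R A. M \<subseteq> B \<longrightarrow> B = M"
  proof (rule subset_Zorn_nonempty)
    show "uminus ` Var R A \<noteq> {}" using exists_prime_over_proper_ideal[OF assms] by simp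
  next
    fix C assume C: "C \<noteq> {}" "subset.chain (uminus ` Var R A) C"
    have sub: "uminus ` C \<subseteq> Var R A"
      using C(2) by (auto simp: subset_chain_def)
    have "primeideal (\<Inter>(uminus ` C)) R"
    proof (rule chain_Inter_is_prime)
      show "primeideal P R" if "P \<in> uminus ` C" for P
        using that sub by (auto simp: Var_def Spec_def)
      show "uminus ` C \<noteq> {}" using C(1) by simp
      show "P \<subseteq> Q \<or> Q \<subseteq> P" if "P \<in> uminus ` C" "Q \<in> uminus ` C" for P Q
        using that C(2) unfolding subset_chain_def by blast
    qed
    moreover have "A \<subseteq> \<Inter>(uminus ` C)" using sub by (auto simp: Var_def)
    ultimately have "\<Inter>(uminus ` C) \<in> Var R A" by (simp add: Var_def Spec_def)
    moreover have "\<Union>C = - \<Inter>(uminus ` C)" by auto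
    ultimately show "\<Union>C \<in> uminus ` Var R A" by blast
  qed
  then obtain P where P: "P \<in> Var R A"
    and max: "\<forall>B\<in>uminus ` Var R A. - P \<subseteq> B \<longrightarrow> B = - P"
    by (elim bexE imageE) simp
  have "Q = P" if "Q \<in> Var R A" "Q \<subseteq> P" for Q
    using bspec[OF max, of "- Q"] that by simp
  with P show ?thesis by (auto simp: min_primes_def)
qed

section \<open>Varieties and powers of ideals\<close>

lemma pow_mem_prime:
  fixes R (structure)
  assumes P: "primeideal P R" and x: "x \<in> carrier R" and "x [^] (n::nat) \<in> P"
  shows "x \<in> P"
proof -
  interpret primeideal P R by (rule P)
  show ?thesis using assms(3)
  proof (induction n)
    case 0
    then show ?case using one_imp_carrier I_notcarr by simp
  next
    case (Suc n)
    then show ?case using I_prime[of "x [^] n" x] x by auto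
  qed
qed

lemma Var_eq_if_radical_equiv:
  assumes "I \<subseteq> J" "J \<subseteq> radical R I"
  shows "Var R J = Var R I"
proof -
  have "J \<subseteq> P" if P: "primeideal P R" "I \<subseteq> P" for P
  proof
    fix x assume "x \<in> J"
    then obtain n :: nat where "x \<in> carrier R" "x [^]\<^bsub>R\<^esub> n \<in> I"
      using assms(2) by (auto simp: radical_def)
    with P show "x \<in> P" by (blast intro: pow_mem_prime)
  qed
  with assms(1) show ?thesis by (auto simp: Var_def Spec_def)
qed

lemma ideal_prod_mono:
  assumes "A \<subseteq> A'" "B \<subseteq> B'"
  shows "ideal_prod R A B \<subseteq> ideal_prod R A' B'"
proof
  fix s assume "s \<in> ideal_prod R A B"
  then show "s \<in> ideal_prod R A' B'"
    using assms by induct (auto intro: ideal_prod.intros)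
qed

lemma ideal_pow_mono:
  assumes "I \<subseteq> J"
  shows "I [^]\<^bsub>ideals_set R\<^esub> (n::nat) \<subseteq> J [^]\<^bsub>ideals_set R\<^esub> n"
proof (induction n)
  case (Suc n)
  then show ?case using ideal_prod_mono[OF _ assms] by (simp add: nat_pow_def ideals_set_def)
qed (simp add: nat_pow_def)

lemma elem_pow_in_ideal_pow:
  assumes "monoid R" "x \<in> I"
  shows "x [^]\<^bsub>R\<^esub> (n::nat) \<in> I [^]\<^bsub>ideals_set R\<^esub> n"
proof (induction n)
  case 0
  then show ?case using monoid.one_closed[OF assms(1)] by (simp add: nat_pow_def ideals_set_def)
next
  case (Suc n)
  then show ?case using ideal_prod.prod[OF Suc assms(2)] by (simp add: nat_pow_def ideals_set_def)
qed

lemma (in cring) ideal_pow_in_carrier: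
  assumes "ideal I R"
  shows "I [^]\<^bsub>ideals_set R\<^esub> (n::nat) \<subseteq> carrier R"
proof -
  interpret S: comm_monoid "ideals_set R" by (rule ideals_set_is_comm_monoid)
  have "I [^]\<^bsub>ideals_set R\<^esub> n \<in> carrier (ideals_set R)"
    using assms by (intro S.nat_pow_closed) (simp add: ideals_set_def)
  then show ?thesis by (auto simp: ideals_set_def dest: ideal.Icarr)
qed

section \<open>Torsion and the weak assassin\<close>

lemma annihilator_carrier_update [simp]:
  "annihilator R (M\<lparr>carrier := N\<rparr>) x = annihilator R M x"
  by (simp add: annihilator_def)

lemma torsion_antimono: "I \<subseteq> J \<Longrightarrow> torsion R J M \<subseteq> torsion R I M"
  unfolding torsion_def using ideal_pow_mono[of I J R] by blast

lemma torsion_subset_carrier: "torsion R I M \<subseteq> carrier M"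
  by (auto simp: torsion_def)

lemma weak_Ass_mono:
  "N \<subseteq> N' \<Longrightarrow> weak_Ass R (M\<lparr>carrier := N\<rparr>) \<subseteq> weak_Ass R (M\<lparr>carrier := N'\<rparr>)"
  by (auto simp: weak_Ass_def)

lemma prime_over_annihilator_of_torsion:
  assumes x: "x \<in> torsion R I M" and I: "ideal I R" and P: "P \<in> Var R (annihilator R M x)"
  shows "P \<in> Var R I"
proof -
  obtain n :: nat where n: "I [^]\<^bsub>ideals_set R\<^esub> n \<subseteq> P"
    using x P by (auto simp: torsion_def Var_def)
  have prime: "primeideal P R" using P by (simp add: Var_def Spec_def)
  interpret ideal I R by (rule I)
  have "I \<subseteq> P"
    using pow_mem_prime[OF prime] elem_pow_in_ideal_pow[OF is_monoid] Icarr n by blast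
  with prime show ?thesis by (simp add: Var_def Spec_def)
qed

lemma weak_Ass_subset_Var:
  assumes "ideal I R"
  shows "weak_Ass R (M\<lparr>carrier := torsion R I M\<rparr>) \<subseteq> Var R I"
  using prime_over_annihilator_of_torsion[OF _ assms, of _ M]
  by (auto simp: weak_Ass_def min_primes_def)

lemma (in module) ideal_annihilator:
  assumes "x \<in> carrier M"
  shows "ideal (annihilator R M x) R"
proof (rule idealI)
  show "ring R" by (rule R.ring_axioms)
  show "subgroup (annihilator R M x) (add_monoid R)"
    using assms
    by (intro R.add.subgroupI) (auto simp: annihilator_def smult_l_distr smult_l_minus
      simp flip: a_inv_def)
next
  fix a r assume a: "a \<in> annihilator R M x" and r: "r \<in> carrier R"
  then show "r \<otimes> a \<in> annihilator R M x"
    using assms by (simp add: annihilator_def smult_assoc1)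
  then show "a \<otimes> r \<in> annihilator R M x"
    using a r by (simp add: annihilator_def R.m_comm)
qed

lemma (in module) zero_in_torsion:
  assumes "ideal I R"
  shows "\<zero>\<^bsub>M\<^esub> \<in> torsion R I M"
proof -
  have "I [^]\<^bsub>ideals_set R\<^esub> (0::nat) \<subseteq> annihilator R M \<zero>\<^bsub>M\<^esub>"
    using R.ideal_pow_in_carrier[OF assms, of 0] by (auto simp: annihilator_def)
  then show ?thesis unfolding torsion_def by blast
qed

lemma (in module) torsion_trivial_if_no_weak_Ass:
  assumes I: "ideal I R" and none: "weak_Ass R M \<inter> Var R I = {}"
  shows "torsion R I M = {\<zero>\<^bsub>M\<^esub>}"
proof -
  have "x = \<zero>\<^bsub>M\<^esub>" if x: "x \<in> torsion R I M" for x
  proof (rule ccontr)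
    assume nz: "x \<noteq> \<zero>\<^bsub>M\<^esub>"
    have xM: "x \<in> carrier M" using x by (simp add: torsion_def)
    have "\<one> \<notin> annihilator R M x" using nz xM by (simp add: annihilator_def)
    then obtain P where P: "P \<in> min_primes R (annihilator R M x)"
      using R.exists_min_prime[OF ideal_annihilator[OF xM]] by blast
    then have "P \<in> Var R (annihilator R M x)" by (simp add: min_primes_def)
    moreover from this have "P \<in> weak_Ass R M"
      using P xM by (auto simp: weak_Ass_def Var_def)
    ultimately show False
      using none prime_over_annihilator_of_torsion[OF x I] by blast
  qed
  with zero_in_torsion[OF I] show ?thesis by blast
qed

section \<open>Descent from \<open>J\<close> to \<open>I\<close>\<close>

lemma weakly_quasifair_module_descend:
  assumes "ideal I R" "I \<subseteq> J" "J \<subseteq> radical R I" "weakly_quasifair_module R J M"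
  shows "weakly_quasifair_module R I M"
proof -
  let ?G = "\<lambda>K. weak_Ass R (M\<lparr>carrier := torsion R K M\<rparr>)"
  have "?G J \<subseteq> ?G I" by (rule weak_Ass_mono[OF torsion_antimono[OF assms(2)]])
  moreover have "?G I \<subseteq> weak_Ass R M"
    by (auto simp: weak_Ass_def torsion_def)
  moreover have "?G I \<subseteq> Var R I" by (rule weak_Ass_subset_Var[OF assms(1)])
  moreover have "?G J = weak_Ass R M \<inter> Var R I"
    using assms(4) Var_eq_if_radical_equiv[OF assms(2,3)]
    by (simp add: weakly_quasifair_module_def)
  ultimately show ?thesis unfolding weakly_quasifair_module_def by blast
qed

lemma half_centred_descend:
  assumes "ideal I R" "I \<subseteq> J" "J \<subseteq> radical R I" "half_centred TYPE('m) R J"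
  shows "half_centred TYPE('m) R I"
  unfolding half_centred_def
proof (intro allI impI iffI)
  fix M :: "('a, 'm) module"
  assume "torsion R I M = carrier M"
  then show "weak_Ass R M \<subseteq> Var R I" using weak_Ass_subset_Var[OF assms(1), of M] by simp
next
  fix M :: "('a, 'm) module"
  assume "module R M" "weak_Ass R M \<subseteq> Var R I"
  then have "torsion R J M = carrier M"
    using assms(4) Var_eq_if_radical_equiv[OF assms(2,3)] by (simp add: half_centred_def)
  then show "torsion R I M = carrier M"
    using torsion_antimono[OF assms(2), of R M] torsion_subset_carrier[of R I M] by blast
qed

lemma centred_descend:
  assumes "ideal I R" "ideal J R" "I \<subseteq> J" "J \<subseteq> radical R I" "centred TYPE('m) R J"
  shows "centred TYPE('m) R I"
  unfolding centred_def
proof (intro allI impI iffI)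
  fix M :: "('a, 'm) module"
  assume M: "module R M" and "torsion R I M = {\<zero>\<^bsub>M\<^esub>}"
  then have "torsion R J M = {\<zero>\<^bsub>M\<^esub>}"
    using torsion_antimono[OF assms(3), of R M] module.zero_in_torsion[OF M assms(2)] by blast
  then show "weak_Ass R M \<inter> Var R I = {}"
    using assms(5) M Var_eq_if_radical_equiv[OF assms(3,4)] by (simp add: centred_def)
next
  fix M :: "('a, 'm) module"
  assume "module R M" "weak_Ass R M \<inter> Var R I = {}"
  then show "torsion R I M = {\<zero>\<^bsub>M\<^esub>}"
    by (rule module.torsion_trivial_if_no_weak_Ass[OF _ assms(1)])
qed

theorem mainTheorem4:
  fixes R :: "('a, 'r) ring_scheme" and I J :: "'a set"
  assumes "cring R" and "ideal I R" and "ideal J R"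
    and "I \<subseteq> J" and "J \<subseteq> radical R I"
  shows "(\<forall>M :: ('a, 'm) module. module R M \<longrightarrow>
             weakly_quasifair_module R J M \<longrightarrow> weakly_quasifair_module R I M)
       \<and> (weakly_quasifair TYPE('m) R J \<longrightarrow> weakly_quasifair TYPE('m) R I)
       \<and> (half_centred TYPE('m) R J \<longrightarrow> half_centred TYPE('m) R I)
       \<and> (centred TYPE('m) R J \<longrightarrow> centred TYPE('m) R I)
       \<and> (well_centred TYPE('m) R J \<longrightarrow> well_centred TYPE('m) R I)"
  by (intro conjI allI impI)
    (auto simp: weakly_quasifair_def well_centred_def
      intro: weakly_quasifair_module_descend[OF assms(2,4,5)]
        half_centred_descend[OF assms(2,4,5)] centred_descend[OF assms(2-5)])

end
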